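(* Let $\mathcal{A}$ be an open set of $\mathbb{R}^2$ and $h:\mathcal{A}\to\mathbb{R}$ a smooth function. Let $I\in\mathcal{A}$ be a point such that $\nabla h(I)\neq 0$. Suppose that $h$ is five-jet non-degenerate at $I$, i.e. that the only $v\in\mathbb{R}^2$ satisfying $$h^1_I[v]=0,\quad h^2_I[v,v]=0,\quad h^3_I[v,v,v]=0,\quad h^4_I[v,v,v,v]=0,\quad h^5_I[v,v,v,v,v]=0$$ is $v=0$. Then $h$ is steep in some neighborhood of $I$.
   Context: Notation: for a smooth function $h$ of $n$ variables, $h_I^k[v^1,\dots,v^k]=\sum_{i_1,\dots,i_k=1}^n \frac{\partial^k h}{\partial I_{i_1}\cdots\partial I_{i_k}}(I)\,v^1_{i_1}\cdots v^k_{i_k}$ for $v^1,\dots,v^k\in\mathbb{R}^n$. Steepness at a point: let $\mathcal{A}\subset\mathbb{R}^n$ be open and $h:\mathcal{A}\to\mathbb{R}$ smooth. $h$ is steep at $I\in\mathcal{A}$ if $\nabla h(I)\neq 0$ and if, for every $m=1,\dots,n-1$, there exist constants $C_m>0$, $\delta_m>0$, $\alpha_m>1$ such that, for all $m$-dimensional affine subspaces $\Lambda_m^I$ through $I$ orthogonal to $\nabla h(I)$, the gradient $\nabla(h|_{\Lambda_m^I})$ of the restriction of $h$ to $\Lambda_m^I$ satisfies $$\max_{0\le\eta\le\xi}\Big(\min_{I'\in\Lambda_m^I,\ \|I-I'\|=\eta}\|\nabla(h|_{\Lambda_m^I})(I')\|\Big)>C_m\xi^{\alpha_m}\qquad\forall\,\xi\in(0,\delta_m].$$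 The $C_m,\delta_m$ are called steepness coefficients and the $\alpha_m$ steepness indices. $h$ is steep in a given domain if it is steep at each point of that domain with uniform indices and coefficients (the same $C_m,\delta_m,\alpha_m$ at all points). *)

theory Defs
  imports "HOL-Analysis.Analysis"
begin

definition partial_deriv :: "'n::finite \<Rightarrow> (real ^ 'n \<Rightarrow> real) \<Rightarrow> real ^ 'n \<Rightarrow> real" where
  "partial_deriv i f x = frechet_derivative f (at x) (axis i 1)"

text \<open>\<open>foldr partial_deriv [i\<^sub>1, \<dots>, i\<^sub>k] f\<close> is the iterated partial derivative of \<open>f\<close>
  with respect to the coordinates \<open>i\<^sub>1, \<dots>, i\<^sub>k\<close>. Requiring all of them to be (totally)
  differentiable on an open set is the same as requiring all of them to exist and to be continuous.\<close>

definition smooth_fun_on :: "(real ^ 'n::finite) set \<Rightarrow> (real ^ 'n \<Rightarrow> real) \<Rightarrow> bool" where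
  "smooth_fun_on A f \<longleftrightarrow> (\<forall>js. \<forall>x\<in>A. foldr partial_deriv js f differentiable (at x))"

text \<open>The form \<open>h\<^sub>I\<^sup>k[v\<^sup>1, \<dots>, v\<^sup>k]\<close>; its degree \<open>k\<close> is the length of the list of vectors.\<close>

definition deriv_form ::
    "(real ^ 'n::finite \<Rightarrow> real) \<Rightarrow> real ^ 'n \<Rightarrow> (real ^ 'n) list \<Rightarrow> real" where
  "deriv_form h I vs =
     (\<Sum>js | length js = length vs.
        foldr partial_deriv js h I * (\<Prod>l<length vs. vs ! l $ (js ! l)))"

definition five_jet_nondegenerate :: "(real ^ 'n::finite \<Rightarrow> real) \<Rightarrow> real ^ 'n \<Rightarrow> bool" where
  "five_jet_nondegenerate h I \<longleftrightarrow>
     (\<forall>v. deriv_form h I [v] = 0 \<and> deriv_form h I [v, v] = 0 \<and>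
          deriv_form h I [v, v, v] = 0 \<and> deriv_form h I [v, v, v, v] = 0 \<and>
          deriv_form h I [v, v, v, v, v] = 0 \<longrightarrow> v = 0)"

text \<open>The gradient at \<open>x\<close> of the restriction of \<open>f\<close> to an affine subspace \<open>L\<close> containing \<open>x\<close>: the
  unique vector in the direction of \<open>L\<close> (that is, with \<open>x + g \<in> L\<close>) that represents the derivative
  of \<open>f\<close> along \<open>L\<close>. For \<open>L = UNIV\<close> it is the usual gradient.\<close>

definition gradient_on :: "'a::euclidean_space set \<Rightarrow> ('a \<Rightarrow> real) \<Rightarrow> 'a \<Rightarrow> 'a" where
  "gradient_on L f x =
     (THE g. x + g \<in> L \<and> (f has_derivative (\<lambda>w. g \<bullet> w)) (at x within L))"

abbreviation gradient :: "('a::euclidean_space \<Rightarrow> real) \<Rightarrow> 'a \<Rightarrow> 'a" where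
  "gradient f x \<equiv> gradient_on UNIV f x"

text \<open>Steepness at \<open>I\<close> of \<open>h : A \<rightarrow> \<real>\<close> with prescribed coefficients \<open>C m\<close>, \<open>\<delta> m\<close> and indices \<open>\<alpha> m\<close>.
  The inclusion in \<open>A\<close> says that every point entering the inequality lies in the domain
  of \<open>h\<close>. The supremum and the infimum are then the maximum and the minimum: for smooth \<open>h\<close>, the norm
  of the gradient is continuous on the compact set \<open>L \<inter> cball I (\<delta> m)\<close>.\<close>

definition steep_at_with ::
    "(real ^ 'n::finite) set \<Rightarrow> (real ^ 'n \<Rightarrow> real) \<Rightarrow> (nat \<Rightarrow> real) \<Rightarrow> (nat \<Rightarrow> real) \<Rightarrow> (nat \<Rightarrow> real) \<Rightarrow>
     real ^ 'n \<Rightarrow> bool" where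
  "steep_at_with A h C \<delta> \<alpha> I \<longleftrightarrow>
     I \<in> A \<and> gradient h I \<noteq> 0 \<and>
     (\<forall>m\<in>{1..<CARD('n)}.
        C m > 0 \<and> \<delta> m > 0 \<and> \<alpha> m > 1 \<and>
        (\<forall>L. affine L \<and> aff_dim L = int m \<and> I \<in> L \<and> (\<forall>x\<in>L. orthogonal (x - I) (gradient h I)) \<longrightarrow>
             L \<inter> cball I (\<delta> m) \<subseteq> A \<and>
             (\<forall>\<xi>\<in>{0<..\<delta> m}.
                (SUP \<eta>\<in>{0..\<xi>}. INF I'\<in>{I'\<in>L. norm (I - I') = \<eta>}. norm (gradient_on L h I'))
                  > C m * \<xi> powr \<alpha> m)))"

definition steep_at ::
    "(real ^ 'n::finite) set \<Rightarrow> (real ^ 'n \<Rightarrow> real) \<Rightarrow> real ^ 'n \<Rightarrow> bool" where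
  "steep_at A h I \<longleftrightarrow> (\<exists>C \<delta> \<alpha>. steep_at_with A h C \<delta> \<alpha> I)"

text \<open>Steepness in a domain \<open>D \<subseteq> A\<close>, with coefficients and indices uniform over \<open>D\<close>.\<close>

definition steep_on ::
    "(real ^ 'n::finite) set \<Rightarrow> (real ^ 'n \<Rightarrow> real) \<Rightarrow> (real ^ 'n) set \<Rightarrow> bool" where
  "steep_on A h D \<longleftrightarrow> (\<exists>C \<delta> \<alpha>. \<forall>I\<in>D. steep_at_with A h C \<delta> \<alpha> I)"

end

theory Submission
  imports Defs
begin

text \<open>In the plane the only affine line through \<open>x\<close> orthogonal to the gradient is \<open>t \<mapsto> x + t e(x)\<close>,
  where \<open>e(x)\<close> is the unit vector obtained by rotating and normalising the gradient, so \<open>e\<close> is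
  continuous near \<open>I\<close>. Non-degeneracy gives some \<open>p\<close> with \<open>1 \<le> p \<le> 4\<close> such that the derivative of
  order \<open>p + 1\<close> of \<open>h\<close> along this line does not vanish at \<open>I\<close>; by continuity the derivative of order
  \<open>p\<close> of \<open>g(t) = \<nabla>h(x + t e(x)) \<bullet> e(x)\<close> is bounded away from \<open>0\<close> uniformly for \<open>x\<close> near \<open>I\<close> and
  small \<open>t\<close>. A function whose \<open>p\<close>-th derivative is at least \<open>c\<close> in absolute value on an interval of
  length \<open>l\<close> is itself at least a multiple of \<open>c l\<^sup>p\<close> on a subinterval of proportional length. Applying
  this to \<open>g(t)\<close> on \<open>[0, \<xi>]\<close>, and then to \<open>g(-t)\<close> on the subinterval found, yields one radius that
  works at both points of the line at that distance from \<open>x\<close>.\<close>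

section \<open>Lower bounds for functions of one variable with a large derivative\<close>

text \<open>By the mean value theorem \<open>g\<close> moves by at least
  \<open>s * \<bar>u - t\<bar>\<close> between \<open>t\<close> and \<open>u\<close>. If
  \<open>\<bar>g t\<bar>\<close> is below \<open>s * (b - a) / 6\<close>, then at distance at least
  a third of the interval from \<open>t\<close> the value is at least (1/3 - 1/6) of
  \<open>s * (b - a)\<close>. The end sixth on the other side of the midpoint from \<open>t\<close>
  keeps that distance, since 1/2 - 1/6 = 1/3.\<close>

lemma subinterval_abs_ge_of_deriv_abs_ge:
  fixes g g' :: "real \<Rightarrow> real"
  assumes "a < b"
    and deriv: "\<And>t. a \<le> t \<Longrightarrow> t \<le> b \<Longrightarrow> (g has_real_derivative g' t) (at t)"
    and ge: "\<And>t. a \<le> t \<Longrightarrow> t \<le> b \<Longrightarrow> s \<le> \<bar>g' t\<bar>"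
    and "0 \<le> s"
  obtains a' b' where "a \<le> a'" "b' \<le> b" "b' - a' = (b - a) / 6"
    "\<And>t. a' \<le> t \<Longrightarrow> t \<le> b' \<Longrightarrow> s * (b - a) / 6 \<le> \<bar>g t\<bar>"
proof -
  have expand: "s * \<bar>u - t\<bar> \<le> \<bar>g u - g t\<bar>" if "a \<le> t" "t \<le> b" "a \<le> u" "u \<le> b" for t u
  proof -
    have main: "s * (y - x) \<le> \<bar>g y - g x\<bar>" if xy: "x < y" "a \<le> x" "y \<le> b" for x y
    proof -
      have "\<exists>z. x < z \<and> z < y \<and> g y - g x = (y - x) * g' z"
        using xy by (intro MVT2 deriv) auto
      then obtain z where z: "x < z" "z < y" "g y - g x = (y - x) * g' z"
        by blast
      have "s \<le> \<bar>g' z\<bar>"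
        using z xy by (intro ge) auto
      then have "s * (y - x) \<le> \<bar>g' z\<bar> * (y - x)"
        using xy by (intro mult_right_mono) auto
      then show ?thesis
        using z xy by (simp add: abs_mult mult.commute)
    qed
    show ?thesis
      using main[of t u] main[of u t] that by (cases t u rule: linorder_cases) (auto simp: abs_minus_commute)
  qed
  show thesis
  proof (cases "\<exists>t. a \<le> t \<and> t \<le> b \<and> \<bar>g t\<bar> < s * (b - a) / 6")
    case False
    show thesis
      by (rule that[of a "a + (b - a) / 6"]) (use False \<open>a < b\<close> in \<open>force simp: not_less field_simps\<close>)+
  next
    case True
    then obtain t where t: "a \<le> t" "t \<le> b" "\<bar>g t\<bar> < s * (b - a) / 6"
      by blast
    have far: "s * (b - a) / 6 \<le> \<bar>g u\<bar>" if "a \<le> u" "u \<le> b" "(b - a) / 3 \<le> \<bar>u - t\<bar>" for u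
    proof -
      have "s * ((b - a) / 3) \<le> s * \<bar>u - t\<bar>"
        using that \<open>0 \<le> s\<close> by (intro mult_left_mono) auto
      also have "\<dots> \<le> \<bar>g u - g t\<bar>"
        using that t by (intro expand)
      finally show ?thesis
        using t(3) by linarith
    qed
    show thesis
    proof (cases "t \<le> (a + b) / 2")
      case True
      show thesis
      proof (rule that[of "b - (b - a) / 6" b])
        show "s * (b - a) / 6 \<le> \<bar>g u\<bar>" if "b - (b - a) / 6 \<le> u" "u \<le> b" for u
          using that True \<open>a < b\<close> by (intro far; argo)
      qed (use \<open>a < b\<close> in \<open>simp_all add: field_simps\<close>)
    next
      case False
      show thesis
      proof (rule that[of a "a + (b - a) / 6"])
        show "s * (b - a) / 6 \<le> \<bar>g u\<bar>" if "a \<le> u" "u \<le> a + (b - a) / 6" for u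
          using that False \<open>a < b\<close> by (intro far; argo)
      qed (use \<open>a < b\<close> in \<open>simp_all add: field_simps\<close>)
    qed
  qed
qed

text \<open>Induction on the order: the shifted family \<open>f (Suc j)\<close> yields a subinterval
  on which the first derivative of \<open>f 0\<close> is large, and the one-step bound then applies
  there. The step from \<open>p\<close> to \<open>Suc p\<close> loses a factor 6 in length and
  \<open>6 ^ Suc p\<close> in the bound (6 from the one-step bound, \<open>6 ^ p\<close> from the
  length already lost), whence the exponent 0 + 1 + ... + p.\<close>

lemma subinterval_abs_ge_of_higher_deriv_abs_ge:
  fixes f :: "nat \<Rightarrow> real \<Rightarrow> real"
  assumes "a < b" "0 \<le> c"
    and "\<And>j t. j < p \<Longrightarrow> a \<le> t \<Longrightarrow> t \<le> b \<Longrightarrow> (f j has_real_derivative f (Suc j) t) (at t)"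
    and "\<And>t. a \<le> t \<Longrightarrow> t \<le> b \<Longrightarrow> c \<le> \<bar>f p t\<bar>"
  obtains a' b' where "a \<le> a'" "b' \<le> b" "b' - a' = (b - a) / 6 ^ p"
    "\<And>t. a' \<le> t \<Longrightarrow> t \<le> b' \<Longrightarrow> c * (b - a) ^ p / 6 ^ (\<Sum>{..p}) \<le> \<bar>f 0 t\<bar>"
  using assms(3,4)
proof (induction p arbitrary: f thesis)
  case 0
  from 0(1)[of a b] 0(3) show ?case
    by auto
next
  case (Suc p)
  obtain a1 b1 where 1: "a \<le> a1" "b1 \<le> b" "b1 - a1 = (b - a) / 6 ^ p"
    "\<And>t. a1 \<le> t \<Longrightarrow> t \<le> b1 \<Longrightarrow> c * (b - a) ^ p / 6 ^ (\<Sum>{..p}) \<le> \<bar>f (Suc 0) t\<bar>"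
    by (rule Suc.IH[of "\<lambda>j. f (Suc j)"]) (use Suc.prems in auto)
  have "a1 < b1"
    using 1(3) \<open>a < b\<close> by (metis diff_gt_0_iff_gt divide_pos_pos zero_less_numeral zero_less_power)
  then obtain a2 b2 where 2: "a1 \<le> a2" "b2 \<le> b1" "b2 - a2 = (b1 - a1) / 6"
    "\<And>t. a2 \<le> t \<Longrightarrow> t \<le> b2 \<Longrightarrow> c * (b - a) ^ p / 6 ^ (\<Sum>{..p}) * (b1 - a1) / 6 \<le> \<bar>f 0 t\<bar>"
    by (rule subinterval_abs_ge_of_deriv_abs_ge[of a1 b1 "f 0" "f (Suc 0)" "c * (b - a) ^ p / 6 ^ (\<Sum>{..p})"])
      (use 1 Suc.prems(2)[of 0] \<open>a < b\<close> \<open>0 \<le> c\<close> in auto)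
  have eq: "c * (b - a) ^ p / 6 ^ (\<Sum>{..p}) * (b1 - a1) / 6 = c * (b - a) ^ Suc p / 6 ^ (\<Sum>{..Suc p})"
    using 1(3) by (simp add: power_add mult_ac)
  show ?case
  proof (rule Suc.prems(1)[of a2 b2])
    show "b2 - a2 = (b - a) / 6 ^ Suc p"
      using 1(3) 2(3) by simp
    show "c * (b - a) ^ Suc p / 6 ^ (\<Sum>{..Suc p}) \<le> \<bar>f 0 t\<bar>" if "a2 \<le> t" "t \<le> b2" for t
      using 2(4)[OF that] by (simp only: eq)
  qed (use 1(1,2) 2(1,2) in auto)
qed

lemma exists_radius_both_signs_abs_ge:
  fixes f :: "nat \<Rightarrow> real \<Rightarrow> real"
  assumes "0 < \<xi>" "0 \<le> c"
    and deriv: "\<And>j t. \<bar>t\<bar> \<le> \<xi> \<Longrightarrow> (f j has_real_derivative f (Suc j) t) (at t)"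
    and ge: "\<And>t. \<bar>t\<bar> \<le> \<xi> \<Longrightarrow> c \<le> \<bar>f p t\<bar>"
  shows "\<exists>\<eta>\<in>{0..\<xi>}. \<forall>\<sigma>\<in>{1, -1}. c * (\<xi> / 6 ^ p) ^ p / 6 ^ (\<Sum>{..p}) \<le> \<bar>f 0 (\<sigma> * \<eta>)\<bar>"
proof -
  obtain a b where 1: "0 \<le> a" "b \<le> \<xi>" "b - a = (\<xi> - 0) / 6 ^ p"
    "\<And>t. a \<le> t \<Longrightarrow> t \<le> b \<Longrightarrow> c * (\<xi> - 0) ^ p / 6 ^ (\<Sum>{..p}) \<le> \<bar>f 0 t\<bar>"
    by (rule subinterval_abs_ge_of_higher_deriv_abs_ge[of 0 \<xi> c p f]) (use assms in auto)
  have "a < b"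
    using 1(3) \<open>0 < \<xi>\<close> by (metis diff_gt_0_iff_gt diff_zero divide_pos_pos zero_less_numeral zero_less_power)
  \<comment> \<open>The signs make \<open>f' j\<close> the derivative of order \<open>j\<close> of
    the reflection \<open>t \<mapsto> f 0 (- t)\<close>.\<close>
  define f' where "f' = (\<lambda>j t. (-1) ^ j * f j (- t))"
  have deriv': "(f' j has_real_derivative f' (Suc j) t) (at t)" if "a \<le> t" "t \<le> b" for j t
    unfolding f'_def
    by (rule derivative_eq_intros DERIV_chain2[OF deriv] refl | use that 1 in \<open>simp; fail\<close>)+
  obtain a' b' where 2: "a \<le> a'" "b' \<le> b" "b' - a' = (b - a) / 6 ^ p"
    "\<And>t. a' \<le> t \<Longrightarrow> t \<le> b' \<Longrightarrow> c * (b - a) ^ p / 6 ^ (\<Sum>{..p}) \<le> \<bar>f' 0 t\<bar>"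
    by (rule subinterval_abs_ge_of_higher_deriv_abs_ge[of a b c p f'])
      (use \<open>a < b\<close> \<open>0 \<le> c\<close> deriv' ge 1 in \<open>auto simp: f'_def abs_mult power_abs\<close>)
  have "a' < b'"
    using 2(3) \<open>a < b\<close> by (metis diff_gt_0_iff_gt divide_pos_pos zero_less_numeral zero_less_power)
  have ba: "b - a = \<xi> / 6 ^ p"
    using 1(3) by simp
  \<comment> \<open>The second search starts from an interval of length only
    \<open>\<xi> / 6 ^ p\<close>, so its bound is the smaller one; the first bound is weakened to
    match it.\<close>
  have "c * (\<xi> / 6 ^ p) ^ p / 6 ^ (\<Sum>{..p}) \<le> c * (\<xi> - 0) ^ p / 6 ^ (\<Sum>{..p})"
    using assms(1,2) by (intro divide_right_mono mult_left_mono power_mono) (auto simp: divide_le_eq)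
  also have "\<dots> \<le> \<bar>f 0 a'\<bar>"
    using 1 2 \<open>a' < b'\<close> by (intro 1) auto
  finally show ?thesis
    using 2(4)[of a'] 1 2(1-3) \<open>a' < b'\<close> by (intro bexI[of _ a']) (auto simp: ba f'_def)
qed

section \<open>Gradients and their restriction to lines\<close>

lemma has_derivative_partial_deriv:
  fixes f :: "real ^ 'n::finite \<Rightarrow> real"
  assumes "f differentiable (at x)"
  shows "(f has_derivative (\<lambda>v. \<Sum>i\<in>UNIV. partial_deriv i f x * v $ i)) (at x)"
proof -
  have D: "(f has_derivative frechet_derivative f (at x)) (at x)"
    using assms by (simp add: frechet_derivative_works)
  then have lin: "linear (frechet_derivative f (at x))"
    by (rule has_derivative_linear)
  have "frechet_derivative f (at x) v = (\<Sum>i\<in>UNIV. partial_deriv i f x * v $ i)" for v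
  proof -
    have "frechet_derivative f (at x) v = frechet_derivative f (at x) (\<Sum>i\<in>UNIV. v $ i *\<^sub>R axis i 1)"
      by (simp flip: scalar_mult_eq_scaleR add: basis_expansion)
    also have "\<dots> = (\<Sum>i\<in>UNIV. partial_deriv i f x * v $ i)"
      by (simp add: linear_sum[OF lin] linear_scale[OF lin] partial_deriv_def mult.commute)
    finally show ?thesis .
  qed
  then show ?thesis
    using D by presburger
qed

lemma gradient_eqI:
  fixes f :: "'a::euclidean_space \<Rightarrow> real"
  assumes "(f has_derivative (\<lambda>v. g \<bullet> v)) (at x)"
  shows "gradient f x = g"
  unfolding gradient_on_def
proof (rule the_equality)
  fix g' assume "x + g' \<in> UNIV \<and> (f has_derivative (\<lambda>w. g' \<bullet> w)) (at x)"
  then have "(\<lambda>w. g' \<bullet> w) = (\<lambda>w. g \<bullet> w)"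
    using assms has_derivative_unique by blast
  then show "g' = g"
    by (metis vector_eq_rdot)
qed (use assms in simp)

lemma gradient_eq_partial_deriv:
  fixes f :: "real ^ 'n::finite \<Rightarrow> real"
  assumes "f differentiable (at x)"
  shows "gradient f x = (\<chi> i. partial_deriv i f x)"
  using has_derivative_partial_deriv[OF assms] by (intro gradient_eqI) (simp add: inner_vec_def)

lemma has_derivative_gradient:
  fixes f :: "real ^ 'n::finite \<Rightarrow> real"
  assumes "f differentiable (at x)"
  shows "(f has_derivative (\<lambda>v. gradient f x \<bullet> v)) (at x)"
  using has_derivative_partial_deriv[OF assms] gradient_eq_partial_deriv[OF assms]
  by (simp add: inner_vec_def)

text \<open>Increments within the line are multiples of the unit vector \<open>e\<close>, and on
  these the full gradient and its projection onto \<open>e\<close> have the same inner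
  product.\<close>

lemma gradient_on_line:
  fixes f :: "real ^ 'n::finite \<Rightarrow> real"
  assumes "norm e = 1" "f differentiable (at (x + t *\<^sub>R e))"
  defines "L \<equiv> range (\<lambda>s. x + s *\<^sub>R e)"
  shows "gradient_on L f (x + t *\<^sub>R e) = (gradient f (x + t *\<^sub>R e) \<bullet> e) *\<^sub>R e"
proof -
  define y where "y = x + t *\<^sub>R e"
  define d where "d = gradient f y \<bullet> e"
  have ee: "e \<bullet> e = 1"
    using assms(1) by (simp add: dot_square_norm)
  have D: "(f has_derivative (\<lambda>v. gradient f y \<bullet> v)) (at y within L)"
    using has_derivative_gradient[OF assms(2)] has_derivative_at_withinI by (auto simp: y_def)
  have "(f has_derivative (\<lambda>v. (d *\<^sub>R e) \<bullet> v)) (at y within L)"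
    unfolding has_derivative_within
  proof (intro conjI)
    show "bounded_linear (\<lambda>v. (d *\<^sub>R e) \<bullet> v)"
      by (rule bounded_linear_inner_right)
    have "((\<lambda>z. (1 / norm (z - y)) *\<^sub>R (f z - (f y + gradient f y \<bullet> (z - y)))) \<longlongrightarrow> 0) (at y within L)"
      using D by (simp add: has_derivative_within)
    moreover have "gradient f y \<bullet> (z - y) = (d *\<^sub>R e) \<bullet> (z - y)" if z: "z \<in> L" for z
    proof -
      from z obtain s where "z - y = (s - t) *\<^sub>R e"
        by (auto simp: L_def y_def algebra_simps)
      then show ?thesis
        by (simp add: d_def ee)
    qed
    ultimately show "((\<lambda>z. (1 / norm (z - y)) *\<^sub>R (f z - (f y + (d *\<^sub>R e) \<bullet> (z - y)))) \<longlongrightarrow> 0) (at y within L)"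
      by (elim Lim_transform_within[of _ _ _ _ 1]) auto
  qed
  moreover have "y + d *\<^sub>R e \<in> L"
    by (auto simp: L_def y_def intro!: range_eqI[of _ _ "t + d"] simp: algebra_simps)
  moreover have "g = d *\<^sub>R e"
    if g: "y + g \<in> L" "(f has_derivative (\<lambda>w. g \<bullet> w)) (at y within L)" for g
  proof -
    from g(1) obtain s where s: "g = s *\<^sub>R e"
      by (auto simp: L_def y_def algebra_simps) (metis add_diff_cancel_left' scaleR_left_diff_distrib diff_add_cancel add.commute)
    have line: "((\<lambda>r. y + r *\<^sub>R e) has_derivative (\<lambda>r. r *\<^sub>R e)) (at 0)"
      by (auto intro!: derivative_eq_intros)
    have sub: "range (\<lambda>r. y + r *\<^sub>R e) \<subseteq> L"
      by (auto simp: L_def y_def simp flip: scaleR_left_distrib)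
    \<comment> \<open>Derivatives within a line are determined only along its direction. Uniqueness
      is therefore taken from the real line, by composing with the parametrisation.\<close>
    have chain: "((\<lambda>r. f (y + r *\<^sub>R e)) has_derivative (\<lambda>r. w \<bullet> (r *\<^sub>R e))) (at 0)"
      if "(f has_derivative (\<lambda>v. w \<bullet> v)) (at y within L)" for w
      using has_derivative_in_compose[OF line, of f "\<lambda>v. w \<bullet> v"] that sub
      by (simp add: has_derivative_subset)
    have "(\<lambda>r. g \<bullet> (r *\<^sub>R e)) = (\<lambda>r. gradient f y \<bullet> (r *\<^sub>R e))"
      using has_derivative_unique[OF chain[OF g(2)] chain[OF D]] .
    from fun_cong[OF this, of 1] show ?thesis
      by (simp add: s d_def ee)
  qed
  ultimately have "gradient_on L f y = d *\<^sub>R e"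
    unfolding gradient_on_def by (intro the_equality) (blast, blast)
  then show ?thesis
    by (simp only: y_def d_def)
qed

section \<open>The derivative forms along a line\<close>

lemma sum_lists_length_Suc:
  fixes F :: "'a::finite list \<Rightarrow> 'b::comm_monoid_add"
  shows "(\<Sum>js | length js = Suc k. F js) = (\<Sum>js | length js = k. \<Sum>j\<in>UNIV. F (j # js))"
proof -
  have "(\<Sum>js | length js = Suc k. F js) = (\<Sum>(js, j)\<in>{js. length js = k} \<times> UNIV. F (j # js))"
    by (rule sum.reindex_bij_witness[of _ "\<lambda>(js, j). j # js" "\<lambda>js. (tl js, hd js)"])
      (auto simp: length_Suc_conv)
  then show ?thesis
    by (simp add: sum.cartesian_product)
qed

text \<open>The chain rule adds a sum over one further coordinate, which becomes the head of the
  index list because \<open>foldr\<close> applies the head last. Hence the form of degree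
  \<open>k\<close> on copies of \<open>e\<close> is the derivative of order \<open>k\<close> of
  \<open>h\<close> along the line.\<close>

lemma deriv_form_has_real_derivative:
  fixes h :: "real ^ 'n::finite \<Rightarrow> real"
  assumes "smooth_fun_on A h" "x + t *\<^sub>R e \<in> A"
  shows "((\<lambda>t. deriv_form h (x + t *\<^sub>R e) (replicate k e)) has_real_derivative
           deriv_form h (x + t *\<^sub>R e) (replicate (Suc k) e)) (at t)"
proof -
  have comp: "((\<lambda>t. foldr partial_deriv js h (x + t *\<^sub>R e)) has_real_derivative
      (\<Sum>j\<in>UNIV. foldr partial_deriv (j # js) h (x + t *\<^sub>R e) * e $ j)) (at t)" for js
  proof -
    have "foldr partial_deriv js h differentiable (at (x + t *\<^sub>R e))"
      using assms by (auto simp: smooth_fun_on_def)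
    note D = has_derivative_partial_deriv[OF this]
    have line: "((\<lambda>t. x + t *\<^sub>R e) has_derivative (\<lambda>r. r *\<^sub>R e)) (at t)"
      by (auto intro!: derivative_eq_intros)
    show ?thesis
      unfolding has_field_derivative_def
      by (rule has_derivative_eq_rhs[OF has_derivative_compose[OF line D]])
        (simp add: fun_eq_iff sum_distrib_left mult_ac)
  qed
  have prod: "(\<Prod>l<Suc k. replicate (Suc k) e ! l $ ((j # js) ! l)) =
      e $ j * (\<Prod>l<k. replicate k e ! l $ (js ! l))" for j js
    by (subst prod.lessThan_Suc_shift) simp
  have "((\<lambda>t. deriv_form h (x + t *\<^sub>R e) (replicate k e)) has_real_derivative
      (\<Sum>js | length js = k. (\<Sum>j\<in>UNIV. foldr partial_deriv (j # js) h (x + t *\<^sub>R e) * e $ j) *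
        (\<Prod>l<k. replicate k e ! l $ (js ! l)))) (at t)"
    unfolding deriv_form_def length_replicate by (intro DERIV_sum DERIV_cmult_right comp)
  also have "(\<Sum>js | length js = k. (\<Sum>j\<in>UNIV. foldr partial_deriv (j # js) h (x + t *\<^sub>R e) * e $ j) *
        (\<Prod>l<k. replicate k e ! l $ (js ! l))) = deriv_form h (x + t *\<^sub>R e) (replicate (Suc k) e)"
    unfolding deriv_form_def length_replicate sum_lists_length_Suc prod
    by (simp add: sum_distrib_left sum_distrib_right mult_ac)
  finally show ?thesis .
qed

lemma deriv_form_single:
  fixes h :: "real ^ 'n::finite \<Rightarrow> real"
  assumes "h differentiable (at x)"
  shows "deriv_form h x [v] = gradient h x \<bullet> v"
  using gradient_eq_partial_deriv[OF assms]
  by (simp add: deriv_form_def sum_lists_length_Suc inner_vec_def)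

text \<open>Continuity is joint in the base point and the vector, because the direction of the
  orthogonal line varies with the point.\<close>

lemma isCont_deriv_form:
  fixes h :: "real ^ 'n::finite \<Rightarrow> real"
  assumes "smooth_fun_on A h" "x \<in> A"
  shows "isCont (\<lambda>z. deriv_form h (fst z) (replicate k (snd z))) (x, v)"
proof -
  have *: "isCont (\<lambda>z. foldr partial_deriv js h (fst z)) (x, v)" for js
    using assms by (intro continuous_within_compose2[OF continuous_fst[OF continuous_ident]])
      (auto simp: smooth_fun_on_def intro: differentiable_imp_continuous_within continuous_within_subset)
  have "isCont (\<lambda>z. \<Prod>l<k. snd z $ (js ! l)) (x, v)" for js :: "'n list"
    by (intro continuous_intros)
  moreover have "(\<Prod>l<k. replicate k w ! l $ (js ! l)) = (\<Prod>l<k. w $ (js ! l))"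
    for js and w :: "real ^ 'n"
    by (rule prod.cong) auto
  ultimately show ?thesis
    unfolding deriv_form_def length_replicate
    by (simp only:) (intro continuous_intros *)
qed

section \<open>A criterion for steepness in the plane\<close>

lemma line_orthogonal_eq:
  fixes x e g :: "real ^ 2"
  assumes "norm e = 1" "orthogonal e g" "g \<noteq> 0"
    and L: "affine L" "aff_dim L = 1" "x \<in> L" "\<forall>y\<in>L. orthogonal (y - x) g"
  shows "L = range (\<lambda>s. x + s *\<^sub>R e)"
proof -
  have *: "w = (w \<bullet> e) *\<^sub>R e" if "orthogonal w g" for w
  proof -
    have w: "w $ 1 * g $ 1 + w $ 2 * g $ 2 = 0" and e: "e $ 1 * g $ 1 + e $ 2 * g $ 2 = 0"
      using that assms(2) by (auto simp: orthogonal_def inner_vec_def sum_2)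
    have e1: "e $ 1 * e $ 1 + e $ 2 * e $ 2 = 1"
      using assms(1) by (simp add: norm_eq_1 inner_vec_def sum_2)
    \<comment> \<open>Two vectors orthogonal to the same nonzero \<open>g\<close> have determinant
      zero; since \<open>e\<close> is a unit vector, this gives
      \<open>w = (w \<bullet> e) *\<^sub>R e\<close>.\<close>
    have "(w $ 1 * e $ 2 - w $ 2 * e $ 1) * g $ 1 = 0" "(w $ 1 * e $ 2 - w $ 2 * e $ 1) * g $ 2 = 0"
      using w e by algebra+
    then have "w $ 1 * e $ 2 - w $ 2 * e $ 1 = 0"
      using assms(3) by (auto simp: vec_eq_iff forall_2)
    then have "w $ 1 = (w $ 1 * e $ 1 + w $ 2 * e $ 2) * e $ 1" "w $ 2 = (w $ 1 * e $ 1 + w $ 2 * e $ 2) * e $ 2"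
      using e1 by algebra+
    then show ?thesis
      by (simp add: vec_eq_iff forall_2 inner_vec_def sum_2)
  qed
  have sub: "y = x + ((y - x) \<bullet> e) *\<^sub>R e" if "y \<in> L" for y
    using *[of "y - x"] L(4) that by (simp add: algebra_simps)
  have "L \<noteq> {x}"
    using L(2) by auto
  then obtain y where "y \<in> L" "y \<noteq> x"
    using L(3) by blast
  define s where "s = (y - x) \<bullet> e"
  have y: "y = x + s *\<^sub>R e"
    using sub[OF \<open>y \<in> L\<close>] by (simp add: s_def)
  with \<open>y \<noteq> x\<close> have "s \<noteq> 0"
    by auto
  have "x + t *\<^sub>R e \<in> L" for t
  proof -
    have "(1 - t / s) *\<^sub>R x + (t / s) *\<^sub>R y \<in> L"
      using L(1,3) \<open>y \<in> L\<close> by (intro mem_affine) auto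
    also have "(1 - t / s) *\<^sub>R x + (t / s) *\<^sub>R y = x + t *\<^sub>R e"
      using \<open>s \<noteq> 0\<close> by (simp add: y algebra_simps)
    finally show ?thesis .
  qed
  then show ?thesis
    using sub by auto
qed

text \<open>The coefficients depend on \<open>c\<close>, \<open>p\<close>, \<open>q\<close> and
  \<open>\<delta>\<close> but not on the point, which gives uniformity later. The exponent
  \<open>p * p\<close> comes from the power \<open>(\<xi> / 6 ^ p) ^ p\<close>. As \<xi> is at most
  1, the order \<open>p\<close> may be replaced by any larger \<open>q\<close>, which allows an
  index above 1 even for \<open>p = 1\<close>.\<close>

lemma steep_at_with_planeI:
  fixes h :: "real ^ 2 \<Rightarrow> real"
  assumes smooth: "smooth_fun_on A h" and "x \<in> A" and grad: "gradient h x \<noteq> 0"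
    and e: "norm e = 1" "orthogonal e (gradient h x)"
    and \<delta>: "0 < \<delta>" "\<delta> \<le> 1" and "0 < c" and q: "1 < q" "p \<le> q"
    and mem: "\<And>t. \<bar>t\<bar> \<le> \<delta> \<Longrightarrow> x + t *\<^sub>R e \<in> A"
    and ge: "\<And>t. \<bar>t\<bar> \<le> \<delta> \<Longrightarrow> c \<le> \<bar>deriv_form h (x + t *\<^sub>R e) (replicate (Suc p) e)\<bar>"
  shows "steep_at_with A h (\<lambda>_. c / 6 ^ (p * p + \<Sum>{..p}) / 2) (\<lambda>_. \<delta>) (\<lambda>_. real q) x"
proof -
  define K where "K = c / 6 ^ (p * p + \<Sum>{..p})"
  have "0 < K"
    using \<open>0 < c\<close> by (simp add: K_def)
  \<comment> \<open>The shift by one makes \<open>f 0\<close> the first derivative of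
    \<open>h\<close> along the line, whose absolute value is the norm of the restricted
    gradient.\<close>
  define f where "f = (\<lambda>j t. deriv_form h (x + t *\<^sub>R e) (replicate (Suc j) e))"
  have f: "(f j has_real_derivative f (Suc j) t) (at t)" if "\<bar>t\<bar> \<le> \<delta>" for j t
    unfolding f_def by (rule deriv_form_has_real_derivative[OF smooth mem[OF that]])
  have f_ge: "c \<le> \<bar>f p t\<bar>" if "\<bar>t\<bar> \<le> \<delta>" for t
    unfolding f_def by (rule ge[OF that])
  have diff: "h differentiable (at y)" if "y \<in> A" for y
    using smooth that unfolding smooth_fun_on_def by (metis foldr_Nil id_apply)
  define L where "L = range (\<lambda>s. x + s *\<^sub>R e)"
  have norm_grad: "norm (gradient_on L h (x + t *\<^sub>R e)) = \<bar>f 0 t\<bar>" if "\<bar>t\<bar> \<le> \<delta>" for t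
    using gradient_on_line[OF e(1) diff[OF mem[OF that]]] e(1)
    by (simp add: L_def f_def deriv_form_single[OF diff[OF mem[OF that]]])
  have "L \<inter> cball x \<delta> \<subseteq> A"
    using mem e(1) by (auto simp: L_def dist_norm)
  moreover have "K / 2 * \<xi> powr real q <
      (SUP \<eta>\<in>{0..\<xi>}. INF y\<in>{y\<in>L. norm (x - y) = \<eta>}. norm (gradient_on L h y))"
    if \<xi>: "0 < \<xi>" "\<xi> \<le> \<delta>" for \<xi>
  proof -
    \<comment> \<open>The points of the line at distance \<eta> from \<open>x\<close> are the two
      given by the parameters \<eta> and -\<eta>, which coincide for \<eta> = 0.\<close>
    have INF: "(INF y\<in>{y\<in>L. norm (x - y) = \<eta>}. norm (gradient_on L h y)) = min \<bar>f 0 \<eta>\<bar> \<bar>f 0 (- \<eta>)\<bar>"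
      if "\<eta> \<in> {0..\<xi>}" for \<eta>
    proof -
      have "{y\<in>L. norm (x - y) = \<eta>} = {x + \<eta> *\<^sub>R e, x + (- \<eta>) *\<^sub>R e}"
        using that e(1)
        by (auto simp: L_def abs_if split: if_splits intro: range_eqI[of _ _ "- \<eta>"])
      then show ?thesis
        using norm_grad[of \<eta>] norm_grad[of "- \<eta>"] that \<xi>
        by (simp only: image_insert image_empty) (simp add: cInf_eq_Min)
    qed
    have cont: "continuous_on {- \<xi>..\<xi>} (f 0)"
    proof (rule DERIV_atLeastAtMost_imp_continuous_on)
      show "\<exists>y. (f 0 has_real_derivative y) (at t)" if "- \<xi> \<le> t" "t \<le> \<xi>" for t
        using f[of t 0] that \<xi> by (intro exI) (auto simp: abs_le_iff)
    qed
    \<comment> \<open>Continuity on a compact interval bounds the minima, so that each of them lies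
      below the real supremum.\<close>
    have "continuous_on {0..\<xi>} (\<lambda>\<eta>. min \<bar>f 0 \<eta>\<bar> \<bar>f 0 (- \<eta>)\<bar>)"
      by (intro continuous_intros continuous_on_compose2[OF cont]) auto
    then have bdd: "bdd_above ((\<lambda>\<eta>. min \<bar>f 0 \<eta>\<bar> \<bar>f 0 (- \<eta>)\<bar>) ` {0..\<xi>})"
      by (intro bounded_imp_bdd_above compact_imp_bounded compact_continuous_image) auto
    have "\<exists>\<eta>\<in>{0..\<xi>}. \<forall>\<sigma>\<in>{1, -1}. c * (\<xi> / 6 ^ p) ^ p / 6 ^ (\<Sum>{..p}) \<le> \<bar>f 0 (\<sigma> * \<eta>)\<bar>"
      using \<xi> \<open>0 < c\<close> by (intro exists_radius_both_signs_abs_ge f f_ge) auto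
    then obtain \<eta> where \<eta>: "\<eta> \<in> {0..\<xi>}"
      "c * (\<xi> / 6 ^ p) ^ p / 6 ^ (\<Sum>{..p}) \<le> min \<bar>f 0 \<eta>\<bar> \<bar>f 0 (- \<eta>)\<bar>"
      by auto
    \<comment> \<open>Halving the constant makes the inequality strict.\<close>
    have "K / 2 * \<xi> powr real q < K * \<xi> ^ q"
      using \<xi> \<open>0 < K\<close> by (simp add: powr_realpow)
    also have "\<dots> \<le> K * \<xi> ^ p"
      using \<xi> \<delta> q \<open>0 < K\<close> by (intro mult_left_mono power_decreasing) auto
    also have "\<dots> = c * (\<xi> / 6 ^ p) ^ p / 6 ^ (\<Sum>{..p})"
      by (simp add: K_def power_add power_mult power_divide)
    also note \<eta>(2)
    also have "min \<bar>f 0 \<eta>\<bar> \<bar>f 0 (- \<eta>)\<bar> \<le> (SUP \<eta>\<in>{0..\<xi>}. min \<bar>f 0 \<eta>\<bar> \<bar>f 0 (- \<eta>)\<bar>)"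
      using \<eta>(1) bdd by (rule cSUP_upper)
    also have "\<dots> = (SUP \<eta>\<in>{0..\<xi>}. INF y\<in>{y\<in>L. norm (x - y) = \<eta>}. norm (gradient_on L h y))"
      using INF by (intro SUP_cong) auto
    finally show ?thesis .
  qed
  moreover have "M = L" if "affine M" "aff_dim M = int 1" "x \<in> M" "\<forall>y\<in>M. orthogonal (y - x) (gradient h x)" for M
    unfolding L_def using that e grad by (intro line_orthogonal_eq) auto
  moreover have "{1..<CARD(2)} = {1::nat}"
    by auto
  ultimately show ?thesis
    using assms(2) grad \<delta>(1) \<open>0 < K\<close> q(1)
    unfolding steep_at_with_def K_def[symmetric] by (auto simp: greaterThanAtMost_iff)
qed

section \<open>Uniform constants on a neighborhood\<close>

lemma isCont_imp_tendsto_nhds: "isCont u z \<Longrightarrow> (u \<longlongrightarrow> u z) (nhds z)"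
  by (simp add: isCont_def tendsto_at_iff_tendsto_nhds)

theorem theorem3:
  fixes A :: "(real ^ 2) set" and h :: "real ^ 2 \<Rightarrow> real" and I :: "real ^ 2"
  assumes "open A"
    and "smooth_fun_on A h"
    and "I \<in> A"
    and "gradient h I \<noteq> 0"
    and "five_jet_nondegenerate h I"
  shows "\<exists>U. open U \<and> I \<in> U \<and> U \<subseteq> A \<and> steep_on A h U"
proof -
  have diff: "foldr partial_deriv js h differentiable (at y)" if "y \<in> A" for y js
    using assms(2) that by (auto simp: smooth_fun_on_def)
  note diff0 = diff[where js = "[]", simplified]
  define G where "G = (\<lambda>x. gradient h x)"
  \<comment> \<open>Where the gradient vanishes, division by zero gives \<open>e x = 0\<close>;
    orthogonality thus holds everywhere, the unit norm only off the zeros of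
    \<open>G\<close>.\<close>
  define e where "e = (\<lambda>x. (1 / norm (G x)) *\<^sub>R (\<chi> i. if i = 1 then - (G x $ 2) else G x $ 1 :: real ^ 2))"
  have norm_e: "norm (e x) = 1" if "G x \<noteq> 0" for x
  proof -
    have "norm (\<chi> i. if i = 1 then - (G x $ 2) else G x $ 1 :: real ^ 2) = norm (G x)"
      by (simp add: norm_eq inner_vec_def sum_2)
    with that show ?thesis
      by (simp add: e_def)
  qed
  have orth: "orthogonal (e x) (G x)" for x
    by (simp add: e_def orthogonal_def inner_vec_def sum_2 mult.commute)
  \<comment> \<open>Continuity of the gradient is inherited from the partial derivatives, with which
    it agrees throughout the open set \<open>A\<close>.\<close>
  have "\<forall>\<^sub>F x in nhds I. G x = (\<chi> i. partial_deriv i h x)"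
    using eventually_nhds_in_open[OF assms(1,3)]
    by eventually_elim (simp add: G_def gradient_eq_partial_deriv diff0)
  moreover have "isCont (partial_deriv i h) I" for i
    using diff[OF assms(3), of "[i]"] by (simp add: differentiable_imp_continuous_within)
  then have "isCont (\<lambda>x. \<chi> i. partial_deriv i h x) I"
    unfolding isCont_def by (intro vec_tendstoI) simp
  ultimately have contG: "isCont G I"
    by (simp add: isCont_cong)
  have contGi: "isCont (\<lambda>x. G x $ i) I" for i
    using contG by (intro continuous_intros)
  have "isCont (\<lambda>x. \<chi> i. if i = 1 then - (G x $ 2) else G x $ 1 :: real ^ 2) I"
    unfolding isCont_def
  proof (rule vec_tendstoI)
    fix i :: 2
    show "((\<lambda>x. (\<chi> i. if i = 1 then - (G x $ 2) else G x $ 1 :: real ^ 2) $ i) \<longlongrightarrow>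
        (\<chi> i. if i = 1 then - (G I $ 2) else G I $ 1 :: real ^ 2) $ i) (at I)"
      using contGi[of 1, unfolded isCont_def] tendsto_minus[OF contGi[of 2, unfolded isCont_def]]
      by (cases "i = 1") simp_all
  qed
  then have conte: "isCont e I"
    unfolding e_def using contG assms(4) by (intro continuous_intros) (auto simp: G_def)
  have eI: "e I \<noteq> 0"
    using norm_e[of I] assms(4) by (auto simp: G_def)
  have "deriv_form h I [e I] = 0"
    using orth[of I] by (simp add: deriv_form_single diff0 assms(3) orthogonal_def inner_commute G_def)
  \<comment> \<open>The first form vanishes on \<open>e I\<close> and \<open>e I\<close> is nonzero,
    so non-degeneracy leaves a nonzero form of some degree \<open>Suc p\<close> from 2 to 5.\<close>
  then have "\<exists>p\<in>{1, 2, 3, 4}. deriv_form h I (replicate (Suc p) (e I)) \<noteq> 0"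
    using assms(5) eI unfolding five_jet_nondegenerate_def by (auto simp: numeral_eq_Suc)
  then obtain p where p: "1 \<le> p" "deriv_form h I (replicate (Suc p) (e I)) \<noteq> 0"
    by (metis insertE empty_iff one_le_numeral order_refl)
  \<comment> \<open>Treating the base point and the line parameter as one variable lets continuity
    at \<open>(I, 0)\<close> control both at once.\<close>
  define F where "F = (\<lambda>z. deriv_form h (fst z + snd z *\<^sub>R e (fst z)) (replicate (Suc p) (e (fst z))))"
  define c where "c = \<bar>F (I, 0)\<bar> / 2"
  have "0 < c"
    using p by (simp add: c_def F_def)
  have cont_fst: "isCont fst (I, 0::real)"
    by (rule continuous_fst[OF continuous_ident])
  have conte': "isCont (\<lambda>z. e (fst z)) (I, 0::real)"
    using isCont_o2[OF cont_fst, of e] conte by simp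
  have contP: "isCont (\<lambda>z. fst z + snd z *\<^sub>R e (fst z)) (I, 0)"
    by (intro continuous_add continuous_scaleR cont_fst continuous_snd continuous_ident conte')
  have "isCont F (I, 0)"
    unfolding F_def
    using isCont_o2[OF continuous_Pair[OF contP conte'], of "\<lambda>z. deriv_form h (fst z) (replicate (Suc p) (snd z))"]
      isCont_deriv_form[OF assms(2,3)] by (simp del: replicate_Suc)
  then have "isCont (\<lambda>z. \<bar>F z\<bar>) (I, 0)"
    by (rule isCont_rabs)
  from isCont_imp_tendsto_nhds[OF this] have ev1: "\<forall>\<^sub>F z in nhds (I, 0). c < \<bar>F z\<bar>"
    by (rule order_tendstoD) (use \<open>0 < c\<close> in \<open>simp add: c_def\<close>)
  have ev2: "\<forall>\<^sub>F z in nhds (I, 0). fst z + snd z *\<^sub>R e (fst z) \<in> A"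
    by (rule topological_tendstoD[OF isCont_imp_tendsto_nhds[OF contP] assms(1)]) (use assms(3) in simp)
  have "isCont (\<lambda>z. G (fst z)) (I, 0::real)"
    using isCont_o2[OF cont_fst, of G] contG by simp
  from isCont_imp_tendsto_nhds[OF this] have ev3: "\<forall>\<^sub>F z in nhds (I, 0::real). G (fst z) \<noteq> 0"
    by (rule tendsto_imp_eventually_ne) (use assms(4) in \<open>simp add: G_def\<close>)
  have "\<forall>\<^sub>F z in nhds (I, 0). c < \<bar>F z\<bar> \<and> fst z + snd z *\<^sub>R e (fst z) \<in> A \<and> G (fst z) \<noteq> 0"
    by (intro eventually_conj ev1 ev2 ev3)
  then obtain d where "0 < d"
    and d: "\<forall>z. dist z (I, 0) < d \<longrightarrow> c < \<bar>F z\<bar> \<and> fst z + snd z *\<^sub>R e (fst z) \<in> A \<and> G (fst z) \<noteq> 0"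
    unfolding eventually_nhds_metric by (elim exE conjE)
  have near: "c < \<bar>F (x, t)\<bar> \<and> x + t *\<^sub>R e x \<in> A \<and> G x \<noteq> 0" if "dist x I < d / 2" "\<bar>t\<bar> < d / 2" for x t
  proof -
    have "dist (x, t) (I, 0) \<le> dist x I + \<bar>t\<bar>"
      using sqrt_sum_squares_le_sum_abs[of "dist x I" t] by (simp add: dist_Pair_Pair)
    then show ?thesis
      using spec[OF d, of "(x, t)"] that by simp
  qed
  \<comment> \<open>The bound 1 serves the comparison of powers of \<xi>; \<open>d / 4\<close> keeps
    the closed range of parameters strictly inside the radius \<open>d / 2\<close>.\<close>
  define \<delta> where "\<delta> = min 1 (d / 4)"
  have \<delta>: "0 < \<delta>" "\<delta> \<le> 1" "\<delta> < d / 2"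
    using \<open>0 < d\<close> by (auto simp: \<delta>_def)
  have A: "x \<in> A" if "dist x I < d / 2" for x
    using near[OF that, of 0] \<open>0 < d\<close> by simp
  \<comment> \<open>The index \<open>Suc p\<close> exceeds 1 because \<open>p\<close> is at least
    1.\<close>
  have "steep_at_with A h (\<lambda>_. c / 6 ^ (p * p + \<Sum>{..p}) / 2) (\<lambda>_. \<delta>) (\<lambda>_. real (Suc p)) x"
    if x: "dist x I < d / 2" for x
  proof (rule steep_at_with_planeI[where e = "e x"])
    have "G x \<noteq> 0"
      using near[OF x, of 0] \<open>0 < d\<close> by simp
    then show "gradient h x \<noteq> 0" "norm (e x) = 1" "orthogonal (e x) (gradient h x)"
      using norm_e orth[of x] by (auto simp: G_def)
    show "x + t *\<^sub>R e x \<in> A" "c \<le> \<bar>deriv_form h (x + t *\<^sub>R e x) (replicate (Suc p) (e x))\<bar>"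
      if "\<bar>t\<bar> \<le> \<delta>" for t
      using near[OF x, of t] that \<delta> by (auto simp: F_def)
  qed (use assms(2) A[OF x] \<delta> \<open>0 < c\<close> p(1) in auto)
  then have "steep_on A h (ball I (d / 2))"
    unfolding steep_on_def mem_ball dist_commute[of I] Ball_def by blast
  moreover have "ball I (d / 2) \<subseteq> A"
    using A by (intro subsetI) (simp add: dist_commute)
  moreover have "I \<in> ball I (d / 2)"
    using \<open>0 < d\<close> by simp
  ultimately show ?thesis
    using open_ball by blast
qed

end
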